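(* Let $m\ge 2$, $n\ge 1$, let $\mathcal{A}\in\mathcal{T}(m,n)$ be a semi-symmetric strong M-tensor and let $b\in\mathbb{R}^n$ with $b>0$. Let $\{y_k\}$ and $\{x_k\}$, with $x_k=y_k^{[\frac1{m-1}]}$, be any infinite sequences generated by the Newton algorithm described in the context (run without termination). Then $\{x_k\}$ converges to the unique positive solution $x^*\in\mathbb{R}^n_{++}$ of the equation $\mathcal{A}x^{m-1}-b=0$.
   Context: Tensors. $\mathcal{T}(m,n)$ is the set of real $m$th-order $n$-dimensional tensors $\mathcal{A}=(a_{i_1i_2\ldots i_m})$, $1\le i_1,\ldots,i_m\le n$. For $x\in\mathbb{R}^n$ (or $\mathbb{C}^n$), $\mathcal{A}x^{m-1}$ is the vector with $(\mathcal{A}x^{m-1})_i=\sum_{i_2,\ldots,i_m=1}^n a_{ii_2\ldots i_m}x_{i_2}\cdots x_{i_m}$. $x^{[\alpha]}=(x_1^\alpha,\ldots,x_n^\alpha)^T$ whenever meaningful. $\mathcal{I}$ is the identity tensor ($a_{ii\ldots i}=1$, all other entries $0$). $\lambda\in\mathbb{C}$ is an eigenvalue of $\mathcal{B}$ if $\mathcal{B}x^{m-1}=\lambda x^{[m-1]}$ for some nonzero $x\in\mathbb{C}^n$; $\rho(\mathcal{B})$ is the maximal modulus of the eigenvalues. $\mathcal{A}$ is a strong M-tensor if $\mathcal{A}=s\mathcal{I}-\mathcal{B}$ with $\mathcal{B}$ entrywise nonnegative and $s>\rho(\mathcal{B})$. $\mathcal{A}$ is semi-symmetric if for each $i$ the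 entries $a_{ii_2\ldots i_m}$ are invariant under permutations of $i_2,\ldots,i_m$. Vector inequalities are componentwise; $\mathbb{R}^n_+$ and $\mathbb{R}^n_{++}$ are the sets of nonnegative and of positive vectors; $\|\cdot\|$ is the Euclidean norm. Set-up. $f(y)=\mathcal{A}\big(y^{[\frac1{m-1}]}\big)^{m-1}-b$ for $y\in\mathbb{R}^n_+$, and $f'(y)$ is its Jacobian, for $y\in\mathbb{R}^n_{++}$. For $\epsilon\in(0,1)$, $\mathcal{F}_\epsilon=\{y\in\mathbb{R}^n_+:\ \mathcal{A}(y^{[\frac1{m-1}]})^{m-1}\ge\epsilon b\}$. Newton algorithm. Fix $\epsilon\in(0,1)$, $\sigma\in(0,\tfrac12)$, $\rho\in(0,1)$. Choose $y_0\in\mathcal{F}_\epsilon$. For $k=0,1,2,\ldots$: let $d_k$ be the solution of $f'(y_k)d_k+f(y_k)=0$; let $\alpha_k$ be the largest element of $\{\rho^i: i=0,1,2,\ldots\}$ such that $y_k+\alpha_kd_k\in\mathcal{F}_\epsilon$ and $\|f(y_k+\alpha_kd_k)\|^2\le(1-2\sigma\alpha_k)\|f(y_k)\|^2$; set $y_{k+1}=y_k+\alpha_kd_k$ and $x_{k+1}=y_{k+1}^{[\frac1{m-1}]}$ (with $x_0=y_0^{[\frac1{m-1}]}$). *)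

theory Defs
  imports "HOL-Analysis.Analysis" "HOL-Library.Multiset"
begin

(* A tensor of order m and dimension CARD('n) maps index lists of length m to entries.
   The order is passed separately; values at lists of any other length are irrelevant,
   and no notion below depends on them. *)
type_synonym ('a, 'n) tensor = "'n list \<Rightarrow> 'a"

(* the vector A x^(m-1) *)
definition tensor_apply ::
  "nat \<Rightarrow> ('a::comm_ring_1, 'n::finite) tensor \<Rightarrow> 'a ^ 'n \<Rightarrow> 'a ^ 'n" where
  "tensor_apply m A x =
     (\<chi> i. \<Sum>is | length is = m - 1. A (i # is) * prod_list (map (\<lambda>j. x $ j) is))"

definition id_tensor :: "(real, 'n) tensor" where
  "id_tensor is = (if \<exists>i. is = replicate (length is) i then 1 else 0)"

(* x^[alpha]; only used for vectors with nonnegative entries and alpha > 0 *)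
definition vec_powr :: "real ^ 'n \<Rightarrow> real \<Rightarrow> real ^ 'n::finite" where
  "vec_powr x \<alpha> = (\<chi> i. x $ i powr \<alpha>)"

definition tensor_eigenvalue :: "nat \<Rightarrow> (real, 'n::finite) tensor \<Rightarrow> complex \<Rightarrow> bool" where
  "tensor_eigenvalue m B \<mu> \<longleftrightarrow>
     (\<exists>x :: complex ^ 'n. x \<noteq> 0 \<and>
        tensor_apply m (\<lambda>is. complex_of_real (B is)) x = (\<chi> i. \<mu> * (x $ i) ^ (m - 1)))"

(* For m \<ge> 2 the set of eigenvalues is compact and nonempty, so the supremum is a maximum. *)
definition tensor_spectral_radius :: "nat \<Rightarrow> (real, 'n::finite) tensor \<Rightarrow> real" where
  "tensor_spectral_radius m B = (SUP \<mu>\<in>{\<mu>. tensor_eigenvalue m B \<mu>}. cmod \<mu>)"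

definition strong_M_tensor :: "nat \<Rightarrow> (real, 'n::finite) tensor \<Rightarrow> bool" where
  "strong_M_tensor m A \<longleftrightarrow>
     (\<exists>s B. (\<forall>is. length is = m \<longrightarrow> 0 \<le> B is) \<and>
            (\<forall>is. length is = m \<longrightarrow> A is = s * id_tensor is - B is) \<and>
            s > tensor_spectral_radius m B)"

definition semi_symmetric :: "nat \<Rightarrow> (real, 'n) tensor \<Rightarrow> bool" where
  "semi_symmetric m A \<longleftrightarrow>
     (\<forall>i is js. length is = m - 1 \<longrightarrow> mset is = mset js \<longrightarrow> A (i # is) = A (i # js))"

definition nonneg_vecs :: "(real ^ 'n::finite) set" where
  "nonneg_vecs = {x. \<forall>i. 0 \<le> x $ i}"

definition pos_vecs :: "(real ^ 'n::finite) set" where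
  "pos_vecs = {x. \<forall>i. 0 < x $ i}"

(* f is meaningful on nonnegative vectors only; since it is a total function here, its
   Jacobian at a positive vector is the library's. *)
definition newton_f ::
  "nat \<Rightarrow> (real, 'n::finite) tensor \<Rightarrow> real ^ 'n \<Rightarrow> real ^ 'n \<Rightarrow> real ^ 'n" where
  "newton_f m A b y = tensor_apply m A (vec_powr y (1 / (real m - 1))) - b"

definition newton_feasible ::
  "nat \<Rightarrow> (real, 'n::finite) tensor \<Rightarrow> real ^ 'n \<Rightarrow> real \<Rightarrow> (real ^ 'n) set" where
  "newton_feasible m A b \<epsilon> =
     {y \<in> nonneg_vecs. \<forall>i. tensor_apply m A (vec_powr y (1 / (real m - 1))) $ i \<ge> \<epsilon> * b $ i}"

definition newton_steps ::
  "nat \<Rightarrow> (real, 'n::finite) tensor \<Rightarrow> real ^ 'n \<Rightarrow> real \<Rightarrow> real \<Rightarrow> real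
     \<Rightarrow> real ^ 'n \<Rightarrow> real ^ 'n \<Rightarrow> real set" where
  "newton_steps m A b \<epsilon> \<sigma> \<rho> y d =
     {\<alpha>. (\<exists>i::nat. \<alpha> = \<rho> ^ i) \<and>
          y + \<alpha> *\<^sub>R d \<in> newton_feasible m A b \<epsilon> \<and>
          (norm (newton_f m A b (y + \<alpha> *\<^sub>R d)))\<^sup>2
            \<le> (1 - 2 * \<sigma> * \<alpha>) * (norm (newton_f m A b y))\<^sup>2}"

(* y is an infinite run of the algorithm with Newton directions d and step lengths alpha.
   The largest admissible step is not written with Max because the set of admissible
   steps may be infinite. *)
definition newton_run ::
  "nat \<Rightarrow> (real, 'n::finite) tensor \<Rightarrow> real ^ 'n \<Rightarrow> real \<Rightarrow> real \<Rightarrow> real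
     \<Rightarrow> (nat \<Rightarrow> real ^ 'n) \<Rightarrow> (nat \<Rightarrow> real ^ 'n) \<Rightarrow> (nat \<Rightarrow> real) \<Rightarrow> bool" where
  "newton_run m A b \<epsilon> \<sigma> \<rho> y d \<alpha> \<longleftrightarrow>
     y 0 \<in> newton_feasible m A b \<epsilon> \<and>
     (\<forall>k. jacobian (newton_f m A b) (at (y k)) *v d k + newton_f m A b (y k) = 0 \<and>
          \<alpha> k \<in> newton_steps m A b \<epsilon> \<sigma> \<rho> (y k) (d k) \<and>
          (\<forall>a \<in> newton_steps m A b \<epsilon> \<sigma> \<rho> (y k) (d k). a \<le> \<alpha> k) \<and>
          y (Suc k) = y k + \<alpha> k *\<^sub>R d k)"

end

theory Submission
  imports Defs
begin

text \<open>
  Write \<open>A = s I - B\<close> with \<open>B \<ge> 0\<close>, and substitute \<open>y = x\<^bsup>[m-1]\<^esup>\<close>. The equation becomes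
  \<open>F y = b\<close> with \<open>F y = s y - G y\<close>, where every component of \<open>G\<close> is a nonnegative combination of
  geometric means of \<open>m - 1\<close> coordinates. Hence \<open>G\<close> is monotone, homogeneous of degree one and
  concave on the nonnegative orthant. A feasible \<open>y\<close> satisfies \<open>s y \<ge> F y \<ge> \<epsilon> b > 0\<close>, so that
  \<open>s > 0\<close> and \<open>y > 0\<close>, and this one positive vector with positive image gives the M-matrix
  type facts that are needed:

  \<^item> comparison (\<open>T_A_comparison\<close>): if \<open>F u \<le> c F w\<close> then \<open>u \<le> c w\<close>, by looking at the index
    where \<open>u / w\<close> is largest. This gives uniqueness of the solution, and an upper bound for all
    iterates, since their residuals do not increase;

  \<^item> uniform invertibility (\<open>dT_A_inverse_bound\<close>): by Euler's identity \<open>F'(y) y = F y\<close>, so the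
    same argument shows that the Newton direction satisfies \<open>|d| \<le> t y\<close> componentwise with
    \<open>t = C \<parallel>F y - b\<parallel>\<close>.

  If \<open>|h| \<le> t y\<close> with \<open>t \<le> 1/2\<close>, the inequality of arithmetic and geometric means and
  elementary bounds for \<open>ln\<close> and \<open>exp\<close> enclose \<open>G (y + h)\<close> between its linearisation at \<open>y\<close> and
  that linearisation minus \<open>2 t\<^sup>2 G y\<close> (\<open>T_B_expansion\<close>). Therefore
  \<open>F (y + a d) - b = (1 - a) (F y - b) + r\<close> with \<open>0 \<le> r\<close> and \<open>r = O(a\<^sup>2 \<parallel>F y - b\<parallel>\<^sup>2)\<close>.
  Nonnegativity of \<open>r\<close> preserves feasibility, and its size gives the decrease condition, for all
  \<open>a\<close> below a threshold that is the same for all iterates (\<open>newton_step_admissible\<close>). The step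
  lengths are thus bounded away from zero, and the residuals decay geometrically. So do the
  increments of \<open>y\<^sub>k\<close>, which converges; its limit is positive and solves the equation
  (\<open>newton_run_converges\<close>).
\<close>

section \<open>Geometric means\<close>

lemma sum_list_map_abs_le:
  fixes v :: "'a \<Rightarrow> real"
  assumes "\<And>j. j \<in> set is \<Longrightarrow> \<bar>v j\<bar> \<le> t"
  shows "\<bar>\<Sum>j\<leftarrow>is. v j\<bar> \<le> real (length is) * t"
  using assms
proof (induction "is")
  case Nil
  then show ?case by simp
next
  case (Cons a "is")
  have "\<bar>v a\<bar> \<le> t" "\<bar>\<Sum>j\<leftarrow>is. v j\<bar> \<le> real (length is) * t" using Cons by auto
  then show ?case by (simp add: algebra_simps)
qed

lemma prod_list_powr_nonneg: "0 \<le> (\<Prod>j\<leftarrow>is. (w j :: real) powr p)"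
  by (induction "is") simp_all

lemma prod_list_powr_eq_exp:
  assumes "\<And>j. j \<in> set is \<Longrightarrow> (0::real) < w j"
  shows "(\<Prod>j\<leftarrow>is. w j powr p) = exp (p * (\<Sum>j\<leftarrow>is. ln (w j)))"
  using assms
proof (induction "is")
  case Nil
  then show ?case by simp
next
  case (Cons a "is")
  have "w a powr p = exp (p * ln (w a))" using Cons.prems[of a] by (simp add: powr_def)
  moreover have "(\<Prod>j\<leftarrow>is. w j powr p) = exp (p * (\<Sum>j\<leftarrow>is. ln (w j)))"
    using Cons by simp
  ultimately show ?case by (simp add: exp_add distrib_left)
qed

lemma prod_list_powr_mult:
  assumes "\<And>j. (0::real) \<le> u j" "\<And>j. (0::real) \<le> w j"
  shows "(\<Prod>j\<leftarrow>is. (u j * w j) powr p) = (\<Prod>j\<leftarrow>is. u j powr p) * (\<Prod>j\<leftarrow>is. w j powr p)"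
  using assms by (induction "is") (simp_all add: powr_mult)

lemma powr_inverse_power:
  assumes "0 \<le> (t::real)" "0 < N"
  shows "(t powr (1 / real N)) ^ N = t"
proof (cases "t = 0")
  case False
  then have "0 < t powr (1 / real N)" using assms by simp
  then have "(t powr (1 / real N)) ^ N = (t powr (1 / real N)) powr real N"
    by (simp add: powr_realpow)
  also have "\<dots> = t" using assms by (simp add: powr_powr)
  finally show ?thesis .
qed (use assms in simp)

lemma prod_list_powr_le_scaled:
  assumes "\<And>j. (0::real) \<le> u j" "\<And>j. u j \<le> t * w j" "\<And>j. 0 \<le> w j" "0 \<le> t" "0 \<le> p"
  shows "(\<Prod>j\<leftarrow>is. u j powr p) \<le> (t powr p) ^ length is * (\<Prod>j\<leftarrow>is. w j powr p)"
proof (induction "is")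
  case Nil
  then show ?case by simp
next
  case (Cons a "is")
  have "u a powr p \<le> (t * w a) powr p" using assms by (intro powr_mono2) auto
  also have "\<dots> = t powr p * w a powr p" using assms by (simp add: powr_mult)
  finally have "u a powr p \<le> t powr p * w a powr p" .
  then have "u a powr p * (\<Prod>j\<leftarrow>is. u j powr p)
      \<le> (t powr p * w a powr p) * ((t powr p) ^ length is * (\<Prod>j\<leftarrow>is. w j powr p))"
    using Cons by (intro mult_mono) (auto intro: prod_list_powr_nonneg)
  then show ?case by (simp add: algebra_simps)
qed

text \<open>The upper bound is the inequality of arithmetic and geometric means; the lower one comes
  from \<open>ln (1 + x) \<ge> x - 2 x\<^sup>2\<close> for \<open>|x| \<le> 1/2\<close> and \<open>exp x \<ge> 1 + x\<close>.\<close>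

lemma geometric_mean_bounds:
  fixes v :: "'a \<Rightarrow> real"
  assumes N: "length is = N" "0 < N"
    and v: "\<And>j. j \<in> set is \<Longrightarrow> \<bar>v j\<bar> \<le> t" and t: "t \<le> 1 / 2"
  defines "p \<equiv> 1 / real N"
  shows "(\<Prod>j\<leftarrow>is. (1 + v j) powr p) \<le> 1 + p * (\<Sum>j\<leftarrow>is. v j)"
    and "1 + p * (\<Sum>j\<leftarrow>is. v j) - 2 * t\<^sup>2 \<le> (\<Prod>j\<leftarrow>is. (1 + v j) powr p)"
proof -
  have pos: "0 < 1 + v j" if "j \<in> set is" for j using v[OF that] t by linarith
  have P: "(\<Prod>j\<leftarrow>is. (1 + v j) powr p) = exp (p * (\<Sum>j\<leftarrow>is. ln (1 + v j)))"
    by (rule prod_list_powr_eq_exp) (rule pos)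
  have pN: "p * real N = 1" "0 < p" using N by (simp_all add: p_def)
  define M where "M = 1 + p * (\<Sum>j\<leftarrow>is. v j)"
  have "\<bar>p * (\<Sum>j\<leftarrow>is. v j)\<bar> \<le> p * (real N * t)"
    using sum_list_map_abs_le[of "is" v t] v N pN by (simp add: abs_mult)
  also have "\<dots> = t" using pN by (simp flip: mult.assoc)
  finally have M: "0 < M" using t by (simp add: M_def abs_le_iff)
  have "(\<Sum>j\<leftarrow>is. ln (1 + v j)) \<le> (\<Sum>j\<leftarrow>is. (ln M - 1 + 1 / M) + v j * (1 / M))"
  proof (rule sum_list_mono)
    fix j assume j: "j \<in> set is"
    have "ln ((1 + v j) / M) \<le> (1 + v j) / M - 1"
      by (rule ln_le_minus_one) (use pos[OF j] M in simp)
    moreover have "ln ((1 + v j) / M) = ln (1 + v j) - ln M"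
      using pos[OF j] M by (subst ln_div) auto
    ultimately show "ln (1 + v j) \<le> (ln M - 1 + 1 / M) + v j * (1 / M)"
      by (simp add: add_divide_distrib)
  qed
  also have "\<dots> = real N * (ln M - 1 + 1 / M) + (\<Sum>j\<leftarrow>is. v j) / M"
    by (simp only: sum_list_addf sum_list_mult_const sum_list_triv N(1)) (simp add: distrib_left)
  finally have "p * (\<Sum>j\<leftarrow>is. ln (1 + v j))
      \<le> p * (real N * (ln M - 1 + 1 / M) + (\<Sum>j\<leftarrow>is. v j) / M)"
    using pN by simp
  also have "\<dots> = (p * real N) * (ln M - 1 + 1 / M) + (M - 1) / M"
    by (simp add: M_def algebra_simps)
  also have "\<dots> = ln M" using M by (simp add: pN diff_divide_distrib)
  finally have "(\<Prod>j\<leftarrow>is. (1 + v j) powr p) \<le> exp (ln M)" by (simp only: P exp_le_cancel_iff)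
  then show "(\<Prod>j\<leftarrow>is. (1 + v j) powr p) \<le> 1 + p * (\<Sum>j\<leftarrow>is. v j)"
    using M by (simp only: exp_ln) (simp only: M_def)
  have "(\<Sum>j\<leftarrow>is. v j + - 2 * t\<^sup>2) \<le> (\<Sum>j\<leftarrow>is. ln (1 + v j))"
  proof (rule sum_list_mono)
    fix j assume j: "j \<in> set is"
    have "\<bar>ln (1 + v j) - v j\<bar> \<le> 2 * (v j)\<^sup>2"
      by (rule abs_ln_one_plus_x_minus_x_bound) (use v[OF j] t in linarith)
    moreover have "(v j)\<^sup>2 \<le> t\<^sup>2" using v[OF j] by (simp add: abs_le_square_iff[symmetric])
    ultimately show "v j + - 2 * t\<^sup>2 \<le> ln (1 + v j)" by linarith
  qed
  also have "(\<Sum>j\<leftarrow>is. v j + - 2 * t\<^sup>2) = (\<Sum>j\<leftarrow>is. v j) - real N * (2 * t\<^sup>2)"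
    by (simp only: sum_list_addf sum_list_triv N(1))
  finally have "p * ((\<Sum>j\<leftarrow>is. v j) - real N * (2 * t\<^sup>2)) \<le> p * (\<Sum>j\<leftarrow>is. ln (1 + v j))"
    using pN by simp
  moreover have "p * ((\<Sum>j\<leftarrow>is. v j) - real N * (2 * t\<^sup>2))
      = p * (\<Sum>j\<leftarrow>is. v j) - (p * real N) * (2 * t\<^sup>2)"
    by (simp add: algebra_simps)
  ultimately have "p * (\<Sum>j\<leftarrow>is. v j) - 2 * t\<^sup>2 \<le> p * (\<Sum>j\<leftarrow>is. ln (1 + v j))"
    by (simp add: pN)
  also have "1 + \<dots> \<le> exp \<dots>" by (rule exp_ge_add_one_self)
  finally show "1 + p * (\<Sum>j\<leftarrow>is. v j) - 2 * t\<^sup>2 \<le> (\<Prod>j\<leftarrow>is. (1 + v j) powr p)"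
    by (simp add: P)
qed

lemma has_derivative_prod_list_powr:
  fixes y :: "real ^ 'n"
  assumes y: "\<And>j. 0 < y $ j"
  shows "((\<lambda>y. \<Prod>j\<leftarrow>is. y $ j powr p) has_derivative
    (\<lambda>h. (\<Prod>j\<leftarrow>is. y $ j powr p) * (p * (\<Sum>j\<leftarrow>is. h $ j / y $ j)))) (at y)"
proof (induction "is")
  case Nil
  then show ?case by simp
next
  case (Cons a "is")
  have nth: "((\<lambda>y. y $ a) has_derivative (\<lambda>h. h $ a)) (at y)"
    by (rule bounded_linear_imp_has_derivative) (rule bounded_linear_vec_nth)
  have pw: "((\<lambda>y. y $ a powr p) has_derivative (\<lambda>h. h $ a * (p * (y $ a) powr (p - 1)))) (at y)"
    by (rule DERIV_compose_FDERIV[OF has_real_derivative_powr[OF y] nth])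
  have eq: "(y $ a) powr (p - 1) = y $ a powr p / y $ a" using y[of a] by (simp add: powr_diff)
  show ?case
    unfolding list.map prod_list.Cons
    by (rule has_derivative_eq_rhs[OF has_derivative_mult[OF pw Cons]])
      (simp add: fun_eq_iff eq algebra_simps)
qed

lemma has_derivative_vecI:
  fixes f :: "real ^ 'n \<Rightarrow> real ^ 'n"
  assumes "\<And>i. ((\<lambda>x. f x $ i) has_derivative (\<lambda>h. D h $ i)) (at y)"
  shows "(f has_derivative D) (at y)"
  using assms
  by (subst has_derivative_componentwise_within) (auto simp: Basis_vec_def inner_axis)

lemma finite_type_obtains_maximum:
  fixes f :: "'a::finite \<Rightarrow> real"
  obtains j where "\<And>i. f i \<le> f j"
proof -
  have "Max (range f) \<in> range f" by (intro Max_in) auto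
  then obtain j where "Max (range f) = f j" by (rule rangeE)
  then have "f i \<le> f j" for i by (metis Max_ge finite finite_imageI rangeI)
  then show thesis by (rule that)
qed

section \<open>Splittings of a tensor\<close>

text \<open>A splitting \<open>A = s I - B\<close> with \<open>B\<close> entrywise nonnegative; as everywhere for tensors, only the
  index lists of length \<open>m\<close> matter.\<close>

locale tensor_splitting =
  fixes m :: nat and A B :: "(real, 'n::finite) tensor" and s :: real
  assumes m: "2 \<le> m"
    and B_nonneg: "\<And>is. length is = m \<Longrightarrow> 0 \<le> B is"
    and split: "\<And>is. length is = m \<Longrightarrow> A is = s * id_tensor is - B is"
begin

text \<open>The exponent that recovers \<open>x\<close> from \<open>y = x\<^bsup>[m-1]\<^esup>\<close>.\<close>

definition p :: real where "p = 1 / (real m - 1)"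

lemma p_eq: "p = 1 / real (m - 1)" and p_pos: "0 < p"
  using m by (simp_all add: p_def of_nat_diff)

text \<open>The map \<open>x \<mapsto> C x\<^bsup>m-1\<^esup>\<close> of a tensor \<open>C\<close>, in the variable \<open>y = x\<^bsup>[m-1]\<^esup>\<close>. In the overview above,
  \<open>F\<close> is \<open>T A\<close> and \<open>G\<close> is \<open>T B\<close>.\<close>

definition T :: "(real, 'n) tensor \<Rightarrow> real ^ 'n \<Rightarrow> real ^ 'n" where
  "T C y = tensor_apply m C (vec_powr y p)"

text \<open>The derivative of \<open>T C\<close> at a positive vector \<open>y\<close>, applied to \<open>h\<close>: in logarithmic form, every
  product of powers is multiplied by \<open>p\<close> times the sum of the relative increments \<open>h / y\<close>.\<close>

definition dT :: "(real, 'n) tensor \<Rightarrow> real ^ 'n \<Rightarrow> real ^ 'n \<Rightarrow> real ^ 'n" where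
  "dT C y h = (\<chi> i. \<Sum>is | length is = m - 1.
     C (i # is) * ((\<Prod>j\<leftarrow>is. y $ j powr p) * (p * (\<Sum>j\<leftarrow>is. h $ j / y $ j))))"

lemma T_nth: "T C y $ i = (\<Sum>is | length is = m - 1. C (i # is) * (\<Prod>j\<leftarrow>is. y $ j powr p))"
  by (simp add: T_def tensor_apply_def vec_powr_def)

lemma has_derivative_T:
  assumes "\<And>i. 0 < y $ i"
  shows "(T C has_derivative dT C y) (at y)"
proof (rule has_derivative_vecI)
  fix i
  show "((\<lambda>y. T C y $ i) has_derivative (\<lambda>h. dT C y h $ i)) (at y)"
    unfolding T_nth dT_def vec_lambda_beta
    by (intro has_derivative_sum has_derivative_mult_right has_derivative_prod_list_powr assms)
qed

lemma sum_id_tensor: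
  "(\<Sum>is | length is = m - 1. id_tensor (i # is) * F is) = F (replicate (m - 1) (i::'n))"
proof -
  have "id_tensor (i # is) = (if is = replicate (m - 1) i then 1 else 0)"
    if "length is = m - 1" for "is" :: "'n list"
  proof -
    have "(\<exists>k. i # is = replicate (length (i # is)) k) \<longleftrightarrow> is = replicate (m - 1) i"
      using that by auto
    then show ?thesis by (simp only: id_tensor_def)
  qed
  then have "(\<Sum>is | length is = m - 1. id_tensor (i # is) * F is)
      = (\<Sum>is | length is = m - 1. if is = replicate (m - 1) i then F is else 0)"
    by (intro sum.cong) auto
  also have "\<dots> = F (replicate (m - 1) i)"
    using finite_lists_length_eq[of "UNIV :: 'n set" "m - 1"] by (subst sum.delta) auto
  finally show ?thesis .
qed

lemma sum_split:
  "(\<Sum>is | length is = m - 1. A (i # is) * F is)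
    = s * F (replicate (m - 1) i) - (\<Sum>is | length is = m - 1. B (i # is) * F is)"
proof -
  have "(\<Sum>is | length is = m - 1. A (i # is) * F is)
      = (\<Sum>is | length is = m - 1. s * (id_tensor (i # is) * F is) - B (i # is) * F is)"
    using m by (intro sum.cong) (auto simp: split algebra_simps)
  then show ?thesis
    by (simp only: sum_subtractf sum_id_tensor sum_distrib_left[symmetric])
qed

lemma powr_p_power: "0 \<le> t \<Longrightarrow> (t powr p) ^ (m - 1) = t"
  unfolding p_eq using m by (intro powr_inverse_power) auto

lemma prod_list_map_replicate: "(\<Prod>j\<leftarrow>replicate k i. g j) = (g i :: real) ^ k"
  by (induction k) simp_all

lemma T_A:
  assumes "0 \<le> y $ i"
  shows "T A y $ i = s * y $ i - T B y $ i"
  using assms by (simp add: T_nth sum_split prod_list_map_replicate powr_p_power del: One_nat_def)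

lemma dT_A:
  assumes "0 < y $ i"
  shows "dT A y h $ i = s * h $ i - dT B y h $ i"
proof -
  have "p * (real m - 1) = 1" using m by (simp add: p_def)
  then have "p * (\<Sum>j\<leftarrow>replicate (m - 1) i. h $ j / y $ j) = h $ i / y $ i"
    using m by (simp add: sum_list_replicate of_nat_diff flip: mult.assoc)
  then show ?thesis using assms
    by (simp add: dT_def sum_split prod_list_map_replicate powr_p_power
        del: One_nat_def map_replicate)
qed

lemma B_term_nonneg:
  "length is = m - 1 \<Longrightarrow> 0 \<le> B (i # is) * (\<Prod>j\<leftarrow>is. y $ j powr p)"
  using m by (intro mult_nonneg_nonneg B_nonneg prod_list_powr_nonneg) auto

lemma T_B_nonneg: "0 \<le> T B y $ i"
  unfolding T_nth by (intro sum_nonneg) (auto intro: B_term_nonneg)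

lemma T_B_le_scaled:
  assumes "\<And>j. 0 \<le> u $ j" "\<And>j. u $ j \<le> t * w $ j" "\<And>j. 0 \<le> w $ j" "0 \<le> t"
  shows "T B u $ i \<le> t * T B w $ i"
  unfolding T_nth sum_distrib_left
proof (intro sum_mono)
  fix "is" :: "'n list" assume "is \<in> {is. length is = m - 1}"
  then have l: "length is = m - 1" by simp
  have "(\<Prod>j\<leftarrow>is. u $ j powr p) \<le> (t powr p) ^ length is * (\<Prod>j\<leftarrow>is. w $ j powr p)"
    using assms p_pos by (intro prod_list_powr_le_scaled) auto
  then have "(\<Prod>j\<leftarrow>is. u $ j powr p) \<le> t * (\<Prod>j\<leftarrow>is. w $ j powr p)"
    by (simp only: l powr_p_power[OF assms(4)])
  moreover have "0 \<le> B (i # is)" using l m by (intro B_nonneg) simp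
  ultimately show "B (i # is) * (\<Prod>j\<leftarrow>is. u $ j powr p)
      \<le> t * (B (i # is) * (\<Prod>j\<leftarrow>is. w $ j powr p))"
    using mult_left_mono[of "\<Prod>j\<leftarrow>is. u $ j powr p" "t * (\<Prod>j\<leftarrow>is. w $ j powr p)" "B (i # is)"]
    by (simp add: mult.left_commute)
qed

lemma abs_dT_B_le:
  assumes y: "\<And>j. 0 < y $ j" and h: "\<And>j. \<bar>h $ j\<bar> \<le> t * y $ j"
  shows "\<bar>dT B y h $ i\<bar> \<le> t * T B y $ i"
proof -
  have "\<bar>dT B y h $ i\<bar> \<le> (\<Sum>is | length is = m - 1.
      \<bar>B (i # is) * ((\<Prod>j\<leftarrow>is. y $ j powr p) * (p * (\<Sum>j\<leftarrow>is. h $ j / y $ j)))\<bar>)"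
    unfolding dT_def vec_lambda_beta by (rule sum_abs)
  also have "\<dots> \<le> (\<Sum>is | length is = m - 1. t * (B (i # is) * (\<Prod>j\<leftarrow>is. y $ j powr p)))"
  proof (intro sum_mono)
    fix "is" :: "'n list" assume "is \<in> {is. length is = m - 1}"
    then have l: "length is = m - 1" by simp
    have "\<bar>h $ j / y $ j\<bar> \<le> t" for j
      using y[of j] h[of j] by (simp add: abs_divide divide_le_eq)
    then have "\<bar>\<Sum>j\<leftarrow>is. h $ j / y $ j\<bar> \<le> real (m - 1) * t"
      using sum_list_map_abs_le[of "is" "\<lambda>j. h $ j / y $ j" t] l by simp
    then have "p * \<bar>\<Sum>j\<leftarrow>is. h $ j / y $ j\<bar> \<le> p * (real (m - 1) * t)"
      using p_pos by (simp add: mult_left_mono)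
    also have "\<dots> = t" using m by (simp add: p_eq)
    finally have "B (i # is) * (\<Prod>j\<leftarrow>is. y $ j powr p) * (p * \<bar>\<Sum>j\<leftarrow>is. h $ j / y $ j\<bar>)
        \<le> B (i # is) * (\<Prod>j\<leftarrow>is. y $ j powr p) * t"
      using B_term_nonneg[OF l, of i y] by (intro mult_left_mono)
    moreover have "\<bar>B (i # is) * ((\<Prod>j\<leftarrow>is. y $ j powr p) * (p * (\<Sum>j\<leftarrow>is. h $ j / y $ j)))\<bar>
        = B (i # is) * (\<Prod>j\<leftarrow>is. y $ j powr p) * (p * \<bar>\<Sum>j\<leftarrow>is. h $ j / y $ j\<bar>)"
      using abs_of_nonneg[OF B_term_nonneg[OF l, of i y]] p_pos by (simp add: abs_mult flip: mult.assoc)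
    ultimately show "\<bar>B (i # is) * ((\<Prod>j\<leftarrow>is. y $ j powr p) * (p * (\<Sum>j\<leftarrow>is. h $ j / y $ j)))\<bar>
        \<le> t * (B (i # is) * (\<Prod>j\<leftarrow>is. y $ j powr p))"
      by (simp add: mult.commute)
  qed
  also have "\<dots> = t * T B y $ i" by (simp add: T_nth sum_distrib_left)
  finally show ?thesis .
qed

text \<open>The tangent plane of the concave map \<open>T B\<close> lies above it, by a relative error that is
  quadratic in the relative size of the increment.\<close>

lemma T_B_expansion:
  assumes y: "\<And>j. 0 < y $ j" and h: "\<And>j. \<bar>h $ j\<bar> \<le> t * y $ j" and t: "t \<le> 1 / 2"
  shows "T B (y + h) $ i \<le> T B y $ i + dT B y h $ i"
    and "T B y $ i + dT B y h $ i - 2 * t\<^sup>2 * T B y $ i \<le> T B (y + h) $ i"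
proof -
  define v where "v j = h $ j / y $ j" for j
  have v: "\<bar>v j\<bar> \<le> t" for j
    using y[of j] h[of j] by (simp add: v_def abs_divide divide_le_eq)
  have v0: "0 \<le> 1 + v j" for j using v[of j] t by linarith
  have yh: "(y + h) $ j = y $ j * (1 + v j)" for j
    using y[of j] by (simp add: v_def algebra_simps)
  have step: "(\<Prod>j\<leftarrow>is. (y + h) $ j powr p)
      = (\<Prod>j\<leftarrow>is. y $ j powr p) * (\<Prod>j\<leftarrow>is. (1 + v j) powr p)" for "is"
    unfolding yh by (rule prod_list_powr_mult) (use y v0 in \<open>auto intro: less_imp_le\<close>)
  have gm: "(\<Prod>j\<leftarrow>is. (1 + v j) powr p) \<le> 1 + p * (\<Sum>j\<leftarrow>is. v j)"
      "1 + p * (\<Sum>j\<leftarrow>is. v j) - 2 * t\<^sup>2 \<le> (\<Prod>j\<leftarrow>is. (1 + v j) powr p)"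
    if "length is = m - 1" for "is"
    using geometric_mean_bounds[of "is" "m - 1" v t] that v t m unfolding p_eq by auto
  have "T B (y + h) $ i \<le> (\<Sum>is | length is = m - 1.
      B (i # is) * (\<Prod>j\<leftarrow>is. y $ j powr p) * (1 + p * (\<Sum>j\<leftarrow>is. v j)))"
    unfolding T_nth step
    by (intro sum_mono) (auto simp: mult.assoc[symmetric] intro!: mult_left_mono gm B_term_nonneg)
  also have "\<dots> = T B y $ i + dT B y h $ i"
    by (simp add: T_nth dT_def v_def algebra_simps flip: sum.distrib)
  finally show "T B (y + h) $ i \<le> T B y $ i + dT B y h $ i" .
  have "T B y $ i + dT B y h $ i - 2 * t\<^sup>2 * T B y $ i = (\<Sum>is | length is = m - 1.
      B (i # is) * (\<Prod>j\<leftarrow>is. y $ j powr p) * (1 + p * (\<Sum>j\<leftarrow>is. v j) - 2 * t\<^sup>2))"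
    by (simp add: T_nth dT_def v_def algebra_simps sum_distrib_left flip: sum.distrib sum_subtractf)
  also have "\<dots> \<le> T B (y + h) $ i"
    unfolding T_nth step
    by (intro sum_mono) (auto simp: mult.assoc[symmetric] intro!: mult_left_mono gm B_term_nonneg)
  finally show "T B y $ i + dT B y h $ i - 2 * t\<^sup>2 * T B y $ i \<le> T B (y + h) $ i" .
qed

section \<open>Positivity, comparison and invertibility\<close>

text \<open>A nonnegative vector with positive image is itself positive, and forces \<open>s > 0\<close>. The estimates
  below are relative to such a vector.\<close>

lemma positive_of_T_positive:
  assumes "0 \<le> y $ i" "0 < T A y $ i"
  shows "0 < s" "0 < y $ i" "T A y $ i \<le> s * y $ i"
proof -
  have "T A y $ i \<le> s * y $ i" using T_A[OF assms(1)] T_B_nonneg[of y i] by simp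
  then show "T A y $ i \<le> s * y $ i" .
  with assms have "0 < s * y $ i" by linarith
  with assms(1) show "0 < s" "0 < y $ i" by (auto simp: zero_less_mult_iff)
qed

text \<open>At the index where \<open>u / w\<close> attains its maximum \<open>t\<close>, monotonicity and homogeneity of \<open>T B\<close> give
  \<open>t * T A w \<le> T A u \<le> c * T A w\<close>, hence \<open>t \<le> c\<close>.\<close>

lemma T_A_comparison:
  assumes u: "\<And>i. 0 \<le> u $ i" and w: "\<And>i. 0 \<le> w $ i" "\<And>i. 0 < T A w $ i"
    and le: "\<And>i. T A u $ i \<le> c * T A w $ i"
  shows "u $ i \<le> c * w $ i"
proof -
  have wp: "0 < w $ i" for i using positive_of_T_positive w by blast
  obtain j where j: "\<And>i. u $ i / w $ i \<le> u $ j / w $ j"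
    using finite_type_obtains_maximum[of "\<lambda>i. u $ i / w $ i"] by blast
  define t where "t = u $ j / w $ j"
  have t0: "0 \<le> t" using u[of j] wp[of j] by (simp add: t_def)
  have ut: "u $ i \<le> t * w $ i" for i
    using j[of i] wp[of i] by (simp add: t_def pos_divide_le_eq)
  have uj: "u $ j = t * w $ j" using wp[of j] by (simp add: t_def)
  have "s * u $ j = T A u $ j + T B u $ j" using T_A[of u j] u by simp
  also have "\<dots> \<le> c * T A w $ j + t * T B w $ j"
    by (intro add_mono le T_B_le_scaled u ut w t0)
  also have "\<dots> = c * T A w $ j + t * (s * w $ j - T A w $ j)" using T_A[of w j] w by simp
  finally have "t * T A w $ j \<le> c * T A w $ j" by (simp add: uj algebra_simps)
  then have "t \<le> c" using w(2)[of j] by simp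
  then have "t * w $ i \<le> c * w $ i" using w(1) by (intro mult_right_mono)
  then show ?thesis using ut[of i] by linarith
qed

lemma T_A_injective:
  assumes "\<And>i. 0 \<le> u $ i" "\<And>i. 0 \<le> w $ i" "\<And>i. 0 < T A w $ i" "T A u = T A w"
  shows "u = w"
proof (rule vec_eq_iff[THEN iffD2], intro allI antisym)
  fix i
  show "u $ i \<le> w $ i" using T_A_comparison[of u w 1 i] assms by simp
  show "w $ i \<le> u $ i" using T_A_comparison[of w u 1 i] assms by simp
qed

text \<open>Quantitative invertibility of the derivative, which maps the positive vector \<open>y\<close> to the
  positive vector \<open>T A y\<close> by homogeneity. Here \<open>t\<close> is the largest ratio \<open>|h| / y\<close>, and the argument
  is that of the comparison lemma.\<close>

lemma dT_A_inverse_bound: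
  assumes y: "\<And>i. 0 \<le> y $ i" and pos: "\<And>i. 0 < T A y $ i"
    and le: "\<And>i. \<bar>dT A y h $ i\<bar> \<le> c * T A y $ i"
  shows "\<bar>h $ i\<bar> \<le> c * y $ i"
proof -
  have yp: "0 < y $ i" for i using positive_of_T_positive y pos by blast
  obtain j where j: "\<And>i. \<bar>h $ i\<bar> / y $ i \<le> \<bar>h $ j\<bar> / y $ j"
    using finite_type_obtains_maximum[of "\<lambda>i. \<bar>h $ i\<bar> / y $ i"] by blast
  define t where "t = \<bar>h $ j\<bar> / y $ j"
  have ht: "\<bar>h $ i\<bar> \<le> t * y $ i" for i
    using j[of i] yp[of i] by (simp add: t_def pos_divide_le_eq)
  have s0: "0 < s" using positive_of_T_positive y pos by blast
  have "s * (t * y $ j) = \<bar>s * h $ j\<bar>" using yp[of j] s0 by (simp add: t_def abs_mult)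
  also have "\<dots> \<le> \<bar>dT A y h $ j\<bar> + \<bar>dT B y h $ j\<bar>" using dT_A[OF yp, of h j] by linarith
  also have "\<dots> \<le> c * T A y $ j + t * T B y $ j"
    by (intro add_mono le abs_dT_B_le yp ht)
  also have "\<dots> = c * T A y $ j + t * (s * y $ j - T A y $ j)" using T_A[of y j] y by simp
  finally have "t * T A y $ j \<le> c * T A y $ j" by (simp add: algebra_simps)
  then have "t \<le> c" using pos[of j] by simp
  then have "t * y $ i \<le> c * y $ i" using y by (intro mult_right_mono)
  then show ?thesis using ht[of i] by linarith
qed

section \<open>The Newton step\<close>

lemma newton_f_eq: "newton_f m A b y = T A y - b"
  by (simp add: newton_f_def T_def p_def)

lemma newton_feasible_iff:
  "y \<in> newton_feasible m A b \<epsilon> \<longleftrightarrow> (\<forall>i. 0 \<le> y $ i) \<and> (\<forall>i. \<epsilon> * b $ i \<le> T A y $ i)"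
  by (simp add: newton_feasible_def nonneg_vecs_def T_def p_def)

lemma newton_direction:
  assumes y: "\<And>i. 0 < y $ i"
    and d: "jacobian (newton_f m A b) (at y) *v d + newton_f m A b y = 0"
  shows "dT A y d = b - T A y"
proof -
  have D: "(newton_f m A b has_derivative dT A y) (at y)"
    unfolding newton_f_eq[abs_def]
    using has_derivative_diff[OF has_derivative_T[OF y] has_derivative_const] by simp
  then have "(newton_f m A b has_derivative (\<lambda>h. jacobian (newton_f m A b) (at y) *v h)) (at y)"
    using jacobian_works differentiable_def by blast
  then have "dT A y = (\<lambda>h. jacobian (newton_f m A b) (at y) *v h)"
    using D has_derivative_unique by blast
  then show ?thesis using d by (simp add: newton_f_eq algebra_simps add_eq_0_iff)
qed

lemma dT_scaleR: "dT C y (a *\<^sub>R h) = a *\<^sub>R dT C y h"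
proof -
  have "(\<Sum>j\<leftarrow>is. (a *\<^sub>R h) $ j / y $ j) = a * (\<Sum>j\<leftarrow>is. h $ j / y $ j)" for "is"
    by (simp flip: sum_list_const_mult)
  then show ?thesis by (simp add: dT_def vec_eq_iff sum_distrib_left ac_simps)
qed

text \<open>Along the Newton direction the image exceeds its linear interpolation towards \<open>b\<close>, which
  keeps the iterates feasible, and the excess is quadratic in the step.\<close>

lemma newton_step_expansion:
  assumes y: "\<And>i. 0 < y $ i" and pos: "\<And>i. 0 \<le> T A y $ i"
    and d: "dT A y d = b - T A y"
    and dt: "\<And>i. \<bar>d $ i\<bar> \<le> t * y $ i" and a: "0 \<le> a" "a * t \<le> 1 / 2"
  defines "r \<equiv> T A (y + a *\<^sub>R d) - b - (1 - a) *\<^sub>R (T A y - b)"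
  shows "0 \<le> (y + a *\<^sub>R d) $ i" and "0 \<le> r $ i" and "r $ i \<le> 2 * (a * t)\<^sup>2 * (s * y $ i)"
proof -
  have h: "\<bar>(a *\<^sub>R d) $ j\<bar> \<le> (a * t) * y $ j" for j
    using mult_left_mono[OF dt[of j] a(1)] a(1) by (simp add: abs_mult mult.assoc)
  have "a * t * y $ i \<le> 1 / 2 * y $ i" using a(2) y[of i] by (intro mult_right_mono) auto
  then show nn: "0 \<le> (y + a *\<^sub>R d) $ i" using h[of i] y[of i]
    unfolding vector_add_component by linarith
  have di: "s * d $ i - dT B y d $ i = b $ i - T A y $ i"
    using dT_A[OF y, of d i] by (simp add: d)
  have "r $ i = T A (y + a *\<^sub>R d) $ i - T A y $ i - a * (b $ i - T A y $ i)"
    by (simp add: r_def algebra_simps)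
  also have "\<dots> = T B y $ i + dT B y (a *\<^sub>R d) $ i - T B (y + a *\<^sub>R d) $ i"
    using T_A[OF nn] T_A[of y i] y[of i]
    by (simp add: dT_scaleR di[symmetric] algebra_simps)
  finally have r: "r $ i = T B y $ i + dT B y (a *\<^sub>R d) $ i - T B (y + a *\<^sub>R d) $ i" .
  show "0 \<le> r $ i" using T_B_expansion(1)[OF y h a(2), of i] by (simp add: r)
  have "r $ i \<le> 2 * (a * t)\<^sup>2 * T B y $ i"
    using T_B_expansion(2)[OF y h a(2), of i] by (simp add: r)
  also have "\<dots> \<le> 2 * (a * t)\<^sup>2 * (s * y $ i)"
    using T_A[of y i] y[of i] pos[of i] by (intro mult_left_mono) auto
  finally show "r $ i \<le> 2 * (a * t)\<^sup>2 * (s * y $ i)" .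
qed

text \<open>The power \<open>a\<close> of \<open>\<rho>\<close> only has to satisfy upper bounds in terms of the residual \<open>R\<close> and of a bound \<open>Y\<close> for \<open>y\<close>
  only, so one threshold serves all iterates. The last one makes the error \<open>r\<close> at most a quarter
  of \<open>a R\<close>, which suffices for the decrease condition since \<open>\<sigma> < 1/2\<close>.\<close>

lemma newton_step_admissible:
  fixes y d b :: "real ^ 'n"
  assumes \<epsilon>: "0 < \<epsilon>" "\<epsilon> < 1" and \<sigma>: "\<sigma> < 1 / 2" and b: "\<And>i. 0 < b $ i"
    and y: "y \<in> newton_feasible m A b \<epsilon>" and d: "dT A y d = b - T A y"
    and dt: "\<And>i. \<bar>d $ i\<bar> \<le> C * R * y $ i" and R: "R = norm (T A y - b)" and Y: "\<And>i. y $ i \<le> Y"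
    and a: "a = \<rho> ^ k" "0 < a" "a \<le> 1 / 2" "a * (C * R) \<le> 1 / 2"
    and K: "K = real CARD('n) * (2 * C\<^sup>2 * (s * Y))" "K * a * R \<le> 1 / 4"
  shows "a \<in> newton_steps m A b \<epsilon> \<sigma> \<rho> y d"
proof -
  have y0: "0 \<le> y $ i" and Ty: "\<epsilon> * b $ i \<le> T A y $ i" for i
    using y by (auto simp: newton_feasible_iff)
  have Tpos: "0 < T A y $ i" for i using Ty[of i] mult_pos_pos[OF \<epsilon>(1) b[of i]] by linarith
  have yp: "0 < y $ i" for i using positive_of_T_positive y0 Tpos by blast
  have s: "0 < s" using positive_of_T_positive y0 Tpos by blast
  define r where "r = T A (y + a *\<^sub>R d) - b - (1 - a) *\<^sub>R (T A y - b)"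
  have r: "0 \<le> (y + a *\<^sub>R d) $ i" "0 \<le> r $ i" "r $ i \<le> 2 * (a * (C * R))\<^sup>2 * (s * y $ i)" for i
    unfolding r_def
    using newton_step_expansion[of y d b "C * R" a i] yp Tpos d dt a by (auto intro: less_imp_le)
  have Tr: "T A (y + a *\<^sub>R d) - b = (1 - a) *\<^sub>R (T A y - b) + r" by (simp add: r_def)
  have "\<epsilon> * b $ i \<le> T A (y + a *\<^sub>R d) $ i" for i
  proof -
    have "T A (y + a *\<^sub>R d) $ i = b $ i + (1 - a) * (T A y $ i - b $ i) + r $ i"
      using arg_cong[OF Tr, of "\<lambda>v. v $ i"] by simp
    moreover have "(1 - a) * (\<epsilon> * b $ i - b $ i) \<le> (1 - a) * (T A y $ i - b $ i)"
      using Ty[of i] a by (intro mult_left_mono) auto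
    moreover have "\<epsilon> * b $ i \<le> b $ i + (1 - a) * (\<epsilon> * b $ i - b $ i)"
    proof -
      have "0 \<le> a * ((1 - \<epsilon>) * b $ i)" using a \<epsilon> b[of i] by simp
      then show ?thesis by (simp add: algebra_simps)
    qed
    ultimately show ?thesis using r(2)[of i] by linarith
  qed
  then have feas: "y + a *\<^sub>R d \<in> newton_feasible m A b \<epsilon>"
    using r(1) by (simp add: newton_feasible_iff)
  have R0: "0 \<le> R" by (simp add: R)
  have "norm r \<le> (\<Sum>i\<in>UNIV. \<bar>r $ i\<bar>)" by (rule norm_le_l1_cart)
  also have "\<dots> \<le> (\<Sum>i\<in>(UNIV :: 'n set). 2 * (a * (C * R))\<^sup>2 * (s * Y))"
  proof (intro sum_mono)
    fix i
    have "2 * (a * (C * R))\<^sup>2 * (s * y $ i) \<le> 2 * (a * (C * R))\<^sup>2 * (s * Y)"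
      using s Y[of i] by (intro mult_left_mono) auto
    then show "\<bar>r $ i\<bar> \<le> 2 * (a * (C * R))\<^sup>2 * (s * Y)" using r(2,3)[of i] by linarith
  qed
  also have "\<dots> = (K * a * R) * (a * R)" by (simp add: K(1) power2_eq_square)
  also have "\<dots> \<le> 1 / 4 * (a * R)" using K(2) a R0 by (intro mult_right_mono) auto
  finally have nr: "norm r \<le> a * R / 4" by simp
  have "norm (T A (y + a *\<^sub>R d) - b) \<le> norm ((1 - a) *\<^sub>R (T A y - b)) + norm r"
    unfolding Tr by (rule norm_triangle_ineq)
  also have "\<dots> \<le> (1 - a) * R + a * R / 4" using nr a by (simp add: R)
  finally have "norm (T A (y + a *\<^sub>R d) - b) \<le> (1 - 3 / 4 * a) * R" by (simp add: algebra_simps)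
  then have "(norm (T A (y + a *\<^sub>R d) - b))\<^sup>2 \<le> ((1 - 3 / 4 * a) * R)\<^sup>2"
    by (intro power_mono) auto
  also have "\<dots> = (1 - 3 / 4 * a)\<^sup>2 * R\<^sup>2" by (rule power_mult_distrib)
  also have "\<dots> \<le> (1 - 2 * \<sigma> * a) * R\<^sup>2"
  proof (rule mult_right_mono)
    have "a * a \<le> 1 / 2 * a" using a by (intro mult_right_mono) auto
    moreover have "2 * \<sigma> * a \<le> 1 * a" using \<sigma> a by (intro mult_right_mono) auto
    moreover have "(1 - 3 / 4 * a)\<^sup>2 = 1 - 3 / 2 * a + 9 / 16 * (a * a)"
      by (simp add: power2_eq_square algebra_simps)
    ultimately show "(1 - 3 / 4 * a)\<^sup>2 \<le> 1 - 2 * \<sigma> * a" using a(2) by linarith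
  qed simp
  finally show ?thesis using feas a(1) by (auto simp: newton_steps_def newton_f_eq R)
qed

section \<open>Convergence\<close>

lemma summable_increments_convergent:
  fixes y :: "nat \<Rightarrow> 'a::banach"
  assumes "summable g" "\<And>k. norm (y (Suc k) - y k) \<le> g k"
  shows "convergent y"
proof -
  have "summable (\<lambda>k. y (Suc k) - y k)"
    using summable_comparison_test'[OF assms(1), of 0 "\<lambda>k. y (Suc k) - y k"] assms(2) by blast
  then have "convergent (\<lambda>n. \<Sum>k<n. y (Suc k) - y k)" by (simp add: summable_iff_convergent)
  then have "convergent (\<lambda>n. y n - y 0)" by (simp add: sum_lessThan_telescope)
  then show ?thesis by (simp add: convergent_diff_const_right_iff)
qed

theorem newton_run_converges:
  fixes y d :: "nat \<Rightarrow> real ^ 'n" and b :: "real ^ 'n"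
  assumes \<epsilon>: "0 < \<epsilon>" "\<epsilon> < 1" and \<sigma>: "0 < \<sigma>" "\<sigma> < 1 / 2" and \<rho>: "0 < \<rho>" "\<rho> < 1"
    and b: "\<And>i. 0 < b $ i" and run: "newton_run m A b \<epsilon> \<sigma> \<rho> y d \<alpha>"
  obtains ys where "\<And>i. 0 < ys $ i" "T A ys = b" "y \<longlonglongrightarrow> ys"
proof -
  have steps: "\<alpha> k \<in> newton_steps m A b \<epsilon> \<sigma> \<rho> (y k) (d k)"
    and largest: "\<And>a. a \<in> newton_steps m A b \<epsilon> \<sigma> \<rho> (y k) (d k) \<Longrightarrow> a \<le> \<alpha> k"
    and next_y: "y (Suc k) = y k + \<alpha> k *\<^sub>R d k" for k
    using run by (auto simp: newton_run_def)
  have feasible: "y k \<in> newton_feasible m A b \<epsilon>" for k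
  proof (cases k)
    case 0
    then show ?thesis using run by (simp add: newton_run_def)
  next
    case (Suc j)
    then show ?thesis using steps[of j] by (simp add: newton_steps_def next_y)
  qed
  have y0: "0 \<le> y k $ i" and Ty: "\<epsilon> * b $ i \<le> T A (y k) $ i" for k i
    using feasible[of k] by (auto simp: newton_feasible_iff)
  have Tpos: "0 < T A (y k) $ i" for k i
    using Ty[of i k] mult_pos_pos[OF \<epsilon>(1) b[of i]] by linarith
  have yp: "0 < y k $ i" for k i using positive_of_T_positive y0 Tpos by blast
  have s: "0 < s" using positive_of_T_positive y0 Tpos by blast
  have dir: "dT A (y k) (d k) = b - T A (y k)" for k
    using run by (intro newton_direction yp) (auto simp: newton_run_def)

  define R where "R k = norm (T A (y k) - b)" for k
  have R0: "0 \<le> R k" for k by (simp add: R_def)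
  have decrease: "(R (Suc k))\<^sup>2 \<le> (1 - 2 * \<sigma> * \<alpha> k) * (R k)\<^sup>2" for k
    using steps[of k] by (simp add: newton_steps_def next_y newton_f_eq R_def)
  have \<alpha>: "0 < \<alpha> k" "\<alpha> k \<le> 1" for k
    using steps[of k] \<rho> by (auto simp: newton_steps_def power_le_one)
  have R_le: "R k \<le> R 0" for k
  proof (induction k)
    case (Suc k)
    have "(1 - 2 * \<sigma> * \<alpha> k) * (R k)\<^sup>2 \<le> 1 * (R k)\<^sup>2"
      using \<sigma> \<alpha>[of k] by (intro mult_right_mono) auto
    then have "(R (Suc k))\<^sup>2 \<le> (R k)\<^sup>2" using decrease[of k] by linarith
    then have "R (Suc k) \<le> R k" using R0 by (rule power2_le_imp_le)
    then show ?case using Suc by linarith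
  qed simp

  obtain j where j: "\<And>i. - b $ i \<le> - b $ j"
    using finite_type_obtains_maximum[of "\<lambda>i. - b $ i"] by blast
  define \<beta> where "\<beta> = b $ j"
  have \<beta>: "0 < \<beta>" "\<beta> \<le> b $ i" for i using j[of i] b[of j] by (simp_all add: \<beta>_def)
  have res: "\<bar>T A (y k) $ i - b $ i\<bar> \<le> R k" for k i
    using component_le_norm_cart[of "T A (y k) - b" i] by (simp add: R_def)

  define C where "C = 1 / (\<epsilon> * \<beta>)"
  have C: "0 < C" using \<epsilon> \<beta> by (simp add: C_def)
  have dt: "\<bar>d k $ i\<bar> \<le> C * R k * y k $ i" for k i
  proof (rule dT_A_inverse_bound[OF y0 Tpos])
    fix i
    have "\<bar>dT A (y k) (d k) $ i\<bar> \<le> R k" using res[of k i] by (simp add: dir abs_minus_commute)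
    also have "\<dots> = C * R k * (\<epsilon> * \<beta>)" using \<epsilon> \<beta> by (simp add: C_def)
    also have "\<dots> \<le> C * R k * T A (y k) $ i"
    proof (rule mult_left_mono)
      have "\<epsilon> * \<beta> \<le> \<epsilon> * b $ i" using \<epsilon> \<beta> by simp
      then show "\<epsilon> * \<beta> \<le> T A (y k) $ i" using Ty[of i k] by linarith
    qed (use C R0 in simp)
    finally show "\<bar>dT A (y k) (d k) $ i\<bar> \<le> C * R k * T A (y k) $ i" .
  qed

  \<comment> \<open>The constant is chosen so that \<open>b + R 0 \<le> c \<epsilon> b\<close>, and \<open>\<epsilon> b\<close> is at most the image of \<open>y 0\<close>.\<close>
  define c where "c = (1 + R 0 / \<beta>) / \<epsilon>"
  have c: "0 < c" using \<epsilon> \<beta> R0[of 0] by (simp add: c_def add_pos_nonneg)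
  have y_le: "y k $ i \<le> c * y 0 $ i" for k i
  proof (rule T_A_comparison[OF y0 y0 Tpos])
    fix i
    have "R 0 = R 0 / \<beta> * \<beta>" using \<beta> by simp
    also have "\<dots> \<le> R 0 / \<beta> * b $ i" using \<beta> R0 by (intro mult_left_mono) auto
    finally have "T A (y k) $ i \<le> b $ i + R 0 / \<beta> * b $ i"
      using res[of k i] R_le[of k] by linarith
    also have "\<dots> = (1 + R 0 / \<beta>) * b $ i" by (simp add: distrib_right)
    also have "1 + R 0 / \<beta> = c * \<epsilon>" using \<epsilon> by (simp add: c_def)
    also have "c * \<epsilon> * b $ i = c * (\<epsilon> * b $ i)" by (rule mult.assoc)
    also have "\<dots> \<le> c * T A (y 0) $ i" using c Ty[of i 0] by (intro mult_left_mono) auto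
    finally show "T A (y k) $ i \<le> c * T A (y 0) $ i" .
  qed
  define Y where "Y = c * norm (y 0)"
  have Y: "y k $ i \<le> Y" for k i
  proof -
    have "y 0 $ i \<le> norm (y 0)" using component_le_norm_cart[of "y 0" i] by linarith
    then have "c * y 0 $ i \<le> Y" using c by (simp add: Y_def)
    then show ?thesis using y_le[of k i] by linarith
  qed
  have Y0: "0 \<le> Y" using c by (simp add: Y_def)

  define K where "K = real CARD('n) * (2 * C\<^sup>2 * (s * Y))"
  have K0: "0 \<le> K" using s Y0 by (simp add: K_def)
  \<comment> \<open>Every step length up to \<open>\<delta>\<close> meets the three upper bounds for an accepted step.\<close>
  define \<delta> where "\<delta> = 1 / (2 + 2 * (C * R 0) + 4 * (K * R 0))"
  have CR: "0 \<le> C * R 0" "0 \<le> K * R 0" using C K0 R0 by simp_all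
  then have den: "0 < 2 + 2 * (C * R 0) + 4 * (K * R 0)" by linarith
  then have \<delta>: "0 < \<delta>" by (simp add: \<delta>_def)
  have accept: "\<rho> ^ l \<in> newton_steps m A b \<epsilon> \<sigma> \<rho> (y k) (d k)" if "\<rho> ^ l \<le> \<delta>" for k l
  proof -
    define a where "a = \<rho> ^ l"
    have a0: "0 < a" using \<rho> by (simp add: a_def)
    have "a * (2 + 2 * (C * R 0) + 4 * (K * R 0)) \<le> 1"
      using that den by (simp add: a_def \<delta>_def pos_le_divide_eq)
    then have "2 * a + 2 * (a * (C * R 0)) + 4 * (a * (K * R 0)) \<le> 1" by (simp add: algebra_simps)
    moreover have "0 \<le> a * (C * R 0)" "0 \<le> a * (K * R 0)" using CR a0 by simp_all
    ultimately have *: "a \<le> 1 / 2" "a * (C * R 0) \<le> 1 / 2" "a * (K * R 0) \<le> 1 / 4"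
      using a0 by linarith+
    have "a * (C * R k) \<le> a * (C * R 0)" "K * a * R k \<le> K * a * R 0"
      using R_le[of k] a0 C K0 by (simp_all add: mult_left_mono)
    then have "a * (C * R k) \<le> 1 / 2" "K * a * R k \<le> 1 / 4" using * by (simp_all add: ac_simps)
    then show ?thesis unfolding a_def[symmetric]
      using newton_step_admissible[OF \<epsilon> \<sigma>(2) b feasible dir dt R_def Y a_def a0 *(1) _ K_def] by blast
  qed
  define a where "a = min 1 (\<rho> * \<delta>)"
  have a: "0 < a" "a \<le> 1" using \<rho> \<delta> by (simp_all add: a_def)
  \<comment> \<open>If the accepted power is not the first one, then its predecessor was rejected.\<close>
  have \<alpha>_ge: "a \<le> \<alpha> k" for k
  proof (rule ccontr)
    assume "\<not> a \<le> \<alpha> k"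
    then have lt: "\<alpha> k < 1" "\<alpha> k < \<rho> * \<delta>" by (simp_all add: a_def)
    obtain l where l: "\<alpha> k = \<rho> ^ l" using steps[of k] by (auto simp: newton_steps_def)
    with lt(1) obtain l' where l': "l = Suc l'" by (cases l) auto
    then have "\<rho> ^ l' \<le> \<delta>" using lt(2) l \<rho> by simp
    then have "\<rho> ^ l' \<le> \<rho> ^ l" using largest[OF accept] l by metis
    then show False using \<rho> by (simp add: l')
  qed

  define q where "q = sqrt (1 - 2 * \<sigma> * a)"
  have "\<sigma> * a \<le> \<sigma> * 1" using \<sigma> a by (intro mult_left_mono) auto
  then have "\<sigma> * a < 1 / 2" using \<sigma> by linarith
  then have q: "0 \<le> q" "q < 1" "q\<^sup>2 = 1 - 2 * \<sigma> * a"
    using \<sigma> a by (simp_all add: q_def mult.assoc)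
  have R_geom: "R k \<le> q ^ k * R 0" for k
  proof (induction k)
    case (Suc k)
    have "\<sigma> * a \<le> \<sigma> * \<alpha> k" using \<sigma> \<alpha>_ge by (intro mult_left_mono) auto
    then have "(1 - 2 * \<sigma> * \<alpha> k) * (R k)\<^sup>2 \<le> q\<^sup>2 * (R k)\<^sup>2"
      unfolding q(3) by (intro mult_right_mono) auto
    then have "(R (Suc k))\<^sup>2 \<le> (q * R k)\<^sup>2"
      using decrease[of k] by (simp add: power_mult_distrib)
    then have "R (Suc k) \<le> q * R k"
      by (rule power2_le_imp_le) (intro mult_nonneg_nonneg q R0)
    also have "\<dots> \<le> q * (q ^ k * R 0)" using Suc q by (intro mult_left_mono) auto
    finally show ?case by (simp add: mult.assoc)
  qed simp
  have geom: "(\<lambda>k. q ^ k) \<longlonglongrightarrow> 0" "summable (\<lambda>k. q ^ k)"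
    using q by (simp_all add: LIMSEQ_realpow_zero summable_geometric)

  have increment: "norm (y (Suc k) - y k) \<le> (real CARD('n) * (C * Y * R 0)) * q ^ k" for k
  proof -
    have "norm (y (Suc k) - y k) \<le> norm (d k)"
      using \<alpha>[of k] mult_right_mono[of "\<alpha> k" 1 "norm (d k)"] by (simp add: next_y)
    also have "\<dots> \<le> (\<Sum>i\<in>UNIV. \<bar>d k $ i\<bar>)" by (rule norm_le_l1_cart)
    also have "\<dots> \<le> (\<Sum>i\<in>(UNIV :: 'n set). C * (q ^ k * R 0) * Y)"
    proof (intro sum_mono)
      fix i
      have "C * R k * y k $ i \<le> C * (q ^ k * R 0) * Y"
        using C q R0 R_geom Y y0 by (intro mult_mono) auto
      then show "\<bar>d k $ i\<bar> \<le> C * (q ^ k * R 0) * Y" using dt[of k i] by linarith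
    qed
    finally show ?thesis by (simp add: ac_simps)
  qed
  have "convergent y"
    by (rule summable_increments_convergent[OF summable_mult[OF geom(2)] increment])
  then obtain ys where ys: "y \<longlonglongrightarrow> ys" by (auto simp: convergent_def)

  have ys_pos: "0 < ys $ i" for i
  proof -
    have "\<epsilon> * b $ i / s \<le> y k $ i" for k
      using Ty[of i k] positive_of_T_positive(3)[OF y0 Tpos, of k i] s
      by (simp add: pos_divide_le_eq mult.commute)
    then have "\<epsilon> * b $ i / s \<le> ys $ i"
      using LIMSEQ_le_const[OF tendsto_vec_nth[OF ys, of i]] by blast
    moreover have "0 < \<epsilon> * b $ i / s" using \<epsilon> b[of i] s by simp
    ultimately show ?thesis by linarith
  qed
  have "isCont (T A) ys"
    using has_derivative_T[OF ys_pos] by (rule has_derivative_continuous)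
  then have "(\<lambda>k. T A (y k)) \<longlonglongrightarrow> T A ys" using ys by (rule isCont_tendsto_compose)
  moreover have "(\<lambda>k. T A (y k)) \<longlonglongrightarrow> b"
  proof (rule LIM_zero_cancel, rule Lim_null_comparison)
    show "\<forall>\<^sub>F k in sequentially. norm (T A (y k) - b) \<le> q ^ k * R 0"
      using R_geom by (simp add: R_def)
    show "(\<lambda>k. q ^ k * R 0) \<longlonglongrightarrow> 0" using tendsto_mult_left_zero[OF geom(1)] .
  qed
  ultimately have "T A ys = b" by (rule LIMSEQ_unique)
  with ys_pos ys show thesis by (intro that)
qed

lemma T_vec_powr:
  assumes "\<And>i. 0 \<le> z $ i"
  shows "T C (vec_powr z (real m - 1)) = tensor_apply m C z"
proof -
  have "vec_powr (vec_powr z (real m - 1)) p = z"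
    using assms m by (simp add: vec_powr_def vec_eq_iff p_def powr_powr)
  then show ?thesis by (simp add: T_def)
qed

end

theorem theorem2p6:
  fixes m :: nat
    and A :: "(real, 'n::finite) tensor"
    and b :: "real ^ 'n"
    and \<epsilon> \<sigma> \<rho> :: real
    and x y d :: "nat \<Rightarrow> real ^ 'n"
    and \<alpha> :: "nat \<Rightarrow> real"
  assumes "m \<ge> 2"
    and "semi_symmetric m A"
    and "strong_M_tensor m A"
    and "b \<in> pos_vecs"
    and "0 < \<epsilon>" "\<epsilon> < 1"
    and "0 < \<sigma>" "\<sigma> < 1 / 2"
    and "0 < \<rho>" "\<rho> < 1"
    and "newton_run m A b \<epsilon> \<sigma> \<rho> y d \<alpha>"
    and "\<And>k. x k = vec_powr (y k) (1 / (real m - 1))"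
  shows "\<exists>xs. xs \<in> pos_vecs \<and> tensor_apply m A xs - b = 0 \<and>
           (\<forall>z \<in> pos_vecs. tensor_apply m A z - b = 0 \<longrightarrow> z = xs) \<and>
           x \<longlonglongrightarrow> xs"
proof -
  obtain s B where B: "\<And>is. length is = m \<Longrightarrow> 0 \<le> B is"
      "\<And>is. length is = m \<Longrightarrow> A is = s * id_tensor is - B is"
    using assms(3) unfolding strong_M_tensor_def by blast
  interpret tensor_splitting m A B s using assms(1) B by unfold_locales
  have b: "0 < b $ i" for i using assms(4) by (simp add: pos_vecs_def)
  obtain ys where ys: "\<And>i. 0 < ys $ i" "T A ys = b" "y \<longlonglongrightarrow> ys"
    using newton_run_converges[OF assms(5-10) b assms(11)] by blast
  show ?thesis
  proof (intro exI conjI ballI impI)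
    show "vec_powr ys p \<in> pos_vecs"
      using ys(1) by (simp add: pos_vecs_def vec_powr_def less_imp_neq[THEN not_sym])
    show "tensor_apply m A (vec_powr ys p) - b = 0" using ys(2) by (simp add: T_def)
    show "x \<longlonglongrightarrow> vec_powr ys p"
    proof (rule vec_tendstoI)
      fix i
      have "ys $ i \<noteq> 0" using ys(1)[of i] by simp
      then show "(\<lambda>k. x k $ i) \<longlonglongrightarrow> vec_powr ys p $ i"
        unfolding assms(12) vec_powr_def vec_lambda_beta p_def
        by (intro tendsto_powr tendsto_const tendsto_vec_nth ys(3))
    qed
  next
    fix z :: "real ^ 'n" assume z: "z \<in> pos_vecs" "tensor_apply m A z - b = 0"
    define w where "w = vec_powr z (real m - 1)"
    have z0: "0 \<le> z $ i" for i using z(1) by (simp add: pos_vecs_def less_imp_le)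
    have "w = ys"
    proof (rule T_A_injective)
      show "T A w = T A ys" using T_vec_powr[OF z0] z(2) by (simp add: w_def ys(2))
    qed (use ys b in \<open>simp_all add: w_def vec_powr_def less_imp_le\<close>)
    moreover have "vec_powr w p = z"
      using z0 assms(1) by (simp add: w_def vec_powr_def vec_eq_iff p_def powr_powr)
    ultimately show "z = vec_powr ys p" by simp
  qed
qed

end
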